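(* Let $N,M\in\mathbb{N}$ and let $f:\{0,1\}^N\to\mathbb{R}_+$ have the form $f(\mathbf{x})=\sum_{j=1}^M w_j h_j(g_j(\mathbf{x}))$, where for every $j\in\{1,\dots,M\}$: $w_j\in\mathbb{R}$, $h_j:[0,1]\to\mathbb{R}_+$, $g_j:[0,1]^N\to[0,1]$ is multilinear, and for each $L\in\mathbb{N}$ there are a polynomial $\hat h_{j,L}:[0,1]\to\mathbb{R}$ of degree $L$ and a function $R_{j,L}$ on $[0,1]$ such that $|h_j(s)-\hat h_{j,L}(s)|\le R_{j,L}(s)$ and $\lim_{L\to\infty}R_{j,L}(s)=0$ for all $s\in[0,1]$. Let $G$ be the multilinear relaxation of $f$, let $\widehat{\nabla G_L}$ be the degree-$L$ polynomial estimator of its gradient, and define $R_L(\mathbf{x})=\sum_{j=1}^M |w_j|\,|R_{j,L}(g_j(\mathbf{x}))|$ for $\mathbf{x}\in\{0,1\}^N$. Then for all $\mathbf{y}\in[0,1]^N$ $$\big\|\nabla G(\mathbf{y})-\widehat{\nabla G_L}(\mathbf{y})\big\|_2\le\|\epsilon_L(\mathbf{y})\|_2,$$ where $\epsilon_L(\mathbf{y})=[\epsilon_{i,L}(\mathbf{y})]_{i=1}^N\in\mathbb{R}^N$ and $$\epsilon_{i,L}(\mathbf{y})=\mathbb{E}_{\mathbf{x}\sim\mathbf{y}}[R_L([\mathbf{x}]_{+i})]+\mathbb{E}_{\mathbf{x}\sim\mathbf{y}}[R_L([\mathbf{x}]_{-i})].$$ Moreover, $\lim_{L\to\infty}\|\epsilon_L(\mathbf{y})\|_2=0$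 uniformly on $[0,1]^N$.
   Context: A function of $N$ real variables is multilinear if it is affine in each coordinate separately, i.e. it is of the form $\sum_{\ell\in\mathcal{I}}c_\ell\prod_{i\in\mathcal{J}_\ell}x_i$ with $\mathcal{I}$ a finite index set, $c_\ell\in\mathbb{R}$, $\mathcal{J}_\ell\subseteq\{1,\dots,N\}$ (empty product $=1$). For $\mathbf{y}\in[0,1]^N$, $\mathbf{x}\sim\mathbf{y}$ means that $\mathbf{x}\in\{0,1\}^N$ is a random vector with independent Bernoulli coordinates, $\mathbb{P}[x_i=1]=y_i$. The multilinear relaxation of $f:\{0,1\}^N\to\mathbb{R}$ is $G(\mathbf{y})=\mathbb{E}_{\mathbf{x}\sim\mathbf{y}}[f(\mathbf{x})]=\sum_{\mathbf{x}\in\{0,1\}^N}f(\mathbf{x})\prod_{i:x_i=1}y_i\prod_{i:x_i=0}(1-y_i)$. $[\mathbf{x}]_{+i}$ and $[\mathbf{x}]_{-i}$ denote $\mathbf{x}$ with the $i$-th coordinate set to $1$ and $0$, respectively. The degree-$L$ polynomial estimator of $f$ is $\hat f_L(\mathbf{x})=\sum_{j=1}^M w_j\hat h_{j,L}(g_j(\mathbf{x}))$, $\mathbf{x}\in\{0,1\}^N$, and the gradient estimator $\widehat{\nabla G_L}(\mathbf{y})\in\mathbb{R}^N$ has $i$-th coordinate $\mathbb{E}_{\mathbf{x}\sim\mathbf{y}}[\hat f_L([\mathbf{x}]_{+i})]-\mathbb{E}_{\mathbf{x}\sim\mathbf{y}}[\hat f_L([\mathbf{x}]_{-i})]$. *)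

theory Defs
  imports "HOL-Probability.Probability" "HOL-Computational_Algebra.Polynomial"
begin

abbreviation unit_cube :: "(real ^ 'n) set" where
  "unit_cube \<equiv> cbox 0 1"

definition binary_cube :: "(real ^ 'n) set" where
  "binary_cube = {x. \<forall>i. x $ i = 0 \<or> x $ i = 1}"

text \<open>The index set is taken in \<^typ>\<open>nat\<close>, into which every finite index set embeds.\<close>

definition multilinear_on :: "(real ^ 'n) set \<Rightarrow> (real ^ 'n::finite \<Rightarrow> real) \<Rightarrow> bool" where
  "multilinear_on S g \<longleftrightarrow>
     (\<exists>(I :: nat set) (c :: nat \<Rightarrow> real) (J :: nat \<Rightarrow> 'n set).
        finite I \<and> (\<forall>x\<in>S. g x = (\<Sum>l\<in>I. c l * (\<Prod>i\<in>J l. x $ i))))"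

text \<open>The law of \<open>x \<sim> y\<close>: a random binary vector with independent Bernoulli coordinates,
  coordinate \<open>i\<close> being \<open>1\<close> with probability \<open>y $ i\<close>. It is meaningful only for \<open>y\<close> in the
  unit cube (\<^const>\<open>bernoulli_pmf\<close> truncates its parameter to \<open>[0,1]\<close>).\<close>

definition bernoulli_vec :: "real ^ 'n \<Rightarrow> (real ^ 'n::finite) pmf" where
  "bernoulli_vec y =
     map_pmf (\<lambda>b. \<chi> i. of_bool (b i)) (Pi_pmf UNIV False (\<lambda>i. bernoulli_pmf (y $ i)))"

definition multilinear_relaxation :: "(real ^ 'n \<Rightarrow> real) \<Rightarrow> real ^ 'n::finite \<Rightarrow> real" where
  "multilinear_relaxation f y = measure_pmf.expectation (bernoulli_vec y) f"

lemma multilinear_relaxation_eq_sum: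
  fixes f :: "real ^ 'n::finite \<Rightarrow> real"
  assumes y: "y \<in> unit_cube"
  shows "multilinear_relaxation f y =
    (\<Sum>b\<in>UNIV. f (\<chi> i. of_bool (b i)) * (\<Prod>i\<in>{i. b i}. y $ i) * (\<Prod>i\<in>{i. \<not> b i}. 1 - y $ i))"
proof -
  have y01: "0 \<le> y$i" "y$i \<le> 1" for i using y by (auto simp: mem_box_cart)
  have "pmf (Pi_pmf UNIV False (\<lambda>i. bernoulli_pmf (y $ i))) b = (\<Prod>i\<in>{i. b i}. y$i) * (\<Prod>i\<in>{i. \<not>b i}. (1 - y$i))" for b
  proof -
    have "pmf (Pi_pmf UNIV False (\<lambda>i. bernoulli_pmf (y $ i))) b = (\<Prod>i\<in>UNIV. if b i then y$i else 1 - y$i)"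
      by (subst pmf_Pi') (auto intro!: prod.cong simp: y01)
    also have "\<dots> = (\<Prod>i\<in>{i. b i}. y$i) * (\<Prod>i\<in>{i. \<not>b i}. (1 - y$i))"
      by (subst prod.If_cases) (auto simp: Collect_neg_eq)
    finally show ?thesis .
  qed
  then show ?thesis unfolding multilinear_relaxation_def bernoulli_vec_def integral_map_pmf
    by (subst integral_measure_pmf_real[where A=UNIV]) (auto simp: mult.assoc)
qed

definition set_one :: "'n \<Rightarrow> real ^ 'n \<Rightarrow> real ^ 'n" where
  "set_one i x = (\<chi> k. if k = i then 1 else x $ k)"

definition set_zero :: "'n \<Rightarrow> real ^ 'n \<Rightarrow> real ^ 'n" where
  "set_zero i x = (\<chi> k. if k = i then 0 else x $ k)"

text \<open>The multilinear relaxation lives on the closed unit cube, so its gradient is taken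
  relative to that set. This is unambiguous also on the boundary, since Frechet derivatives
  within a nondegenerate box are unique.\<close>

definition gradient_within ::
    "(real ^ 'n \<Rightarrow> real) \<Rightarrow> real ^ 'n \<Rightarrow> (real ^ 'n) set \<Rightarrow> real ^ 'n::finite" where
  "gradient_within F y S = (\<chi> i. frechet_derivative F (at y within S) (axis i 1))"

lemma gradient_within_unit_cube:
  fixes F :: "real ^ 'n::finite \<Rightarrow> real"
  assumes "(F has_derivative (\<lambda>v. D \<bullet> v)) (at y within unit_cube)" and "y \<in> unit_cube"
  shows "gradient_within F y unit_cube = D"
proof -
  have d: "(F has_derivative frechet_derivative F (at y within unit_cube)) (at y within unit_cube)"
    using assms(1) frechet_derivative_works differentiable_def by blast
  have "frechet_derivative F (at y within unit_cube) = (\<lambda>v. D \<bullet> v)"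
  proof (rule frechet_derivative_unique_within_closed_interval[OF _ assms(2) d assms(1)])
    show "0 \<bullet> b < 1 \<bullet> b" if "b \<in> Basis" for b :: "real ^ 'n"
      using that by (auto simp: Basis_vec_def inner_axis)
  qed
  then show ?thesis
    by (simp add: gradient_within_def vec_eq_iff inner_axis)
qed

definition polynomial_estimator ::
    "nat \<Rightarrow> (nat \<Rightarrow> real) \<Rightarrow> (nat \<Rightarrow> nat \<Rightarrow> real poly) \<Rightarrow> (nat \<Rightarrow> real ^ 'n \<Rightarrow> real)
      \<Rightarrow> nat \<Rightarrow> real ^ 'n \<Rightarrow> real" where
  "polynomial_estimator M w hhat g L x = (\<Sum>j=1..M. w j * poly (hhat j L) (g j x))"

definition gradient_estimator ::
    "nat \<Rightarrow> (nat \<Rightarrow> real) \<Rightarrow> (nat \<Rightarrow> nat \<Rightarrow> real poly) \<Rightarrow> (nat \<Rightarrow> real ^ 'n \<Rightarrow> real)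
      \<Rightarrow> nat \<Rightarrow> real ^ 'n \<Rightarrow> real ^ 'n::finite" where
  "gradient_estimator M w hhat g L y =
     (\<chi> i. measure_pmf.expectation (bernoulli_vec y)
             (\<lambda>x. polynomial_estimator M w hhat g L (set_one i x))
         - measure_pmf.expectation (bernoulli_vec y)
             (\<lambda>x. polynomial_estimator M w hhat g L (set_zero i x)))"

definition residual ::
    "nat \<Rightarrow> (nat \<Rightarrow> real) \<Rightarrow> (nat \<Rightarrow> nat \<Rightarrow> real \<Rightarrow> real) \<Rightarrow> (nat \<Rightarrow> real ^ 'n \<Rightarrow> real)
      \<Rightarrow> nat \<Rightarrow> real ^ 'n \<Rightarrow> real" where
  "residual M w R g L x = (\<Sum>j=1..M. \<bar>w j\<bar> * \<bar>R j L (g j x)\<bar>)"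

definition gradient_error ::
    "nat \<Rightarrow> (nat \<Rightarrow> real) \<Rightarrow> (nat \<Rightarrow> nat \<Rightarrow> real \<Rightarrow> real) \<Rightarrow> (nat \<Rightarrow> real ^ 'n \<Rightarrow> real)
      \<Rightarrow> nat \<Rightarrow> real ^ 'n \<Rightarrow> real ^ 'n::finite" where
  "gradient_error M w R g L y =
     (\<chi> i. measure_pmf.expectation (bernoulli_vec y) (\<lambda>x. residual M w R g L (set_one i x))
         + measure_pmf.expectation (bernoulli_vec y) (\<lambda>x. residual M w R g L (set_zero i x)))"

end

theory Submission
  imports Defs
begin

text \<open>The relaxation is affine in each coordinate, so its \<open>i\<close>-th partial derivative is the exact
  difference of its values with that coordinate pinned to \<open>1\<close> and to \<open>0\<close>. The gradient estimator
  is the same difference for the polynomial estimator, and taking expectations of the pointwise bound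
  \<open>R\<^sub>L\<close> gives the coordinatewise estimate. The bound is uniform because the expectations only see
  the finitely many vertices of the cube.\<close>

text \<open>Coding binary vectors by Boolean functions turns an expectation into a sum over the
  finite type \<open>'n \<Rightarrow> bool\<close>, and pinning a coordinate into a function
  update.\<close>

definition vertex :: "('n \<Rightarrow> bool) \<Rightarrow> real ^ 'n" where
  "vertex b = (\<chi> i. of_bool (b i))"

text \<open>For \<open>t\<close> in the unit interval this is the Bernoulli probability of
  \<open>c\<close>. Being affine in \<open>t\<close> on the whole line, without truncation, it can
  be differentiated directly.\<close>

definition bernoulli_weight :: "bool \<Rightarrow> real \<Rightarrow> real" where
  "bernoulli_weight c t = (if c then t else 1 - t)"

lemma vertex_in_binary_cube: "vertex b \<in> binary_cube"
  by (simp add: vertex_def binary_cube_def)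

lemma binary_cube_subset_unit_cube: "binary_cube \<subseteq> unit_cube"
proof
  fix x :: "real ^ 'n" assume "x \<in> binary_cube"
  then have "0 \<le> x $ i \<and> x $ i \<le> 1" for i
    unfolding binary_cube_def by (metis (mono_tags) mem_Collect_eq order_refl zero_le_one)
  then show "x \<in> unit_cube" by (simp add: mem_box_cart)
qed

lemma set_one_vertex: "set_one i (vertex b) = vertex (b(i := True))"
  by (simp add: set_one_def vertex_def vec_eq_iff)

lemma set_zero_vertex: "set_zero i (vertex b) = vertex (b(i := False))"
  by (simp add: set_zero_def vertex_def vec_eq_iff)

lemma bernoulli_weight_nonneg:
  assumes "y \<in> unit_cube"
  shows "0 \<le> bernoulli_weight c (y $ i)"
  using assms by (auto simp: bernoulli_weight_def mem_box_cart)

lemma bernoulli_weight_le_1: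
  assumes "y \<in> unit_cube"
  shows "bernoulli_weight c (y $ i) \<le> 1"
  using assms by (auto simp: bernoulli_weight_def mem_box_cart)

text \<open>A single product over all coordinates suits both later uses: splitting off one factor
  and applying the product rule.\<close>

lemma expectation_bernoulli_vec:
  fixes y :: "real ^ 'n::finite"
  assumes "y \<in> unit_cube"
  shows "measure_pmf.expectation (bernoulli_vec y) \<phi> =
    (\<Sum>b\<in>UNIV. \<phi> (vertex b) * (\<Prod>k\<in>UNIV. bernoulli_weight (b k) (y $ k)))"
proof -
  have "(\<Prod>k\<in>UNIV. bernoulli_weight (b k) (y $ k)) =
      (\<Prod>k\<in>{k. b k}. y $ k) * (\<Prod>k\<in>{k. \<not> b k}. 1 - y $ k)" for b :: "'n \<Rightarrow> bool"
    unfolding bernoulli_weight_def by (subst prod.If_cases) (auto simp: Collect_neg_eq)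
  then show ?thesis
    using multilinear_relaxation_eq_sum[OF assms, of \<phi>]
    by (simp add: multilinear_relaxation_def vertex_def mult.assoc)
qed

text \<open>Flipping bit \<open>i\<close> is a bijection between the vectors with
  \<open>b i = c\<close> and the others, so the sum can be taken in pairs.\<close>

lemma sum_pin_coordinate:
  fixes \<psi> :: "('n::finite \<Rightarrow> bool) \<Rightarrow> real"
  shows "(\<Sum>b\<in>UNIV. \<psi> b) = (\<Sum>b | b i = c. \<psi> b + \<psi> (b(i := \<not> c)))"
proof -
  have "(\<Sum>b | b i \<noteq> c. \<psi> b) = (\<Sum>b | b i = c. \<psi> (b(i := \<not> c)))"
    by (rule sum.reindex_bij_witness[where i = "\<lambda>b. b(i := \<not> c)" and j = "\<lambda>b. b(i := c)"])
      (auto simp: fun_upd_idem)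
  moreover have "(\<Sum>b\<in>UNIV. \<psi> b) = (\<Sum>b | b i = c. \<psi> b) + (\<Sum>b | b i \<noteq> c. \<psi> b)"
    by (subst sum.union_disjoint[symmetric]) (auto intro!: sum.cong)
  ultimately show ?thesis by (simp add: sum.distrib)
qed

text \<open>Marginalization: once coordinate \<open>i\<close> is pinned, the integrand no longer
  depends on it, and its two weights add up to 1.\<close>

lemma sum_bernoulli_weight_pinned:
  fixes \<psi> :: "('n::finite \<Rightarrow> bool) \<Rightarrow> real" and y :: "real ^ 'n"
  shows "(\<Sum>b\<in>UNIV. \<psi> (b(i := c)) * (\<Prod>k\<in>UNIV. bernoulli_weight (b k) (y $ k))) =
    (\<Sum>b | b i = c. \<psi> b * (\<Prod>k\<in>UNIV - {i}. bernoulli_weight (b k) (y $ k)))"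
    (is "_ = (\<Sum>b | b i = c. \<psi> b * ?Q b)")
proof -
  have split: "(\<Prod>k\<in>UNIV. bernoulli_weight (b k) (y $ k)) =
      bernoulli_weight (b i) (y $ i) * (\<Prod>k\<in>UNIV - {i}. bernoulli_weight (b k) (y $ k))"
    for b :: "'n \<Rightarrow> bool"
    by (rule prod.remove) auto
  have other: "(\<Prod>k\<in>UNIV - {i}. bernoulli_weight ((b(i := d)) k) (y $ k)) =
      (\<Prod>k\<in>UNIV - {i}. bernoulli_weight (b k) (y $ k))" for b :: "'n \<Rightarrow> bool" and d
    by (rule prod.cong) auto
  have total: "bernoulli_weight c t + bernoulli_weight (\<not> c) t = 1" for t
    by (simp add: bernoulli_weight_def)
  show ?thesis
    unfolding sum_pin_coordinate[where i = i and c = c] split other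
  proof (rule sum.cong[OF refl])
    fix b assume "b \<in> {b. b i = c}"
    then have "b i = c" by simp
    moreover from this have "b(i := c) = b" by auto
    \<comment> \<open>Pinning undoes the flip, so both members of a pair carry
      \<open>\<psi> b * ?Q b\<close>, and \<open>total\<close> sums their weights.\<close>
    ultimately show "\<psi> (b(i := c)) * (bernoulli_weight (b i) (y $ i) * ?Q b)
        + \<psi> (b(i := \<not> c, i := c)) * (bernoulli_weight ((b(i := \<not> c)) i) (y $ i) * ?Q b) = \<psi> b * ?Q b"
      using total[of "y $ i"] by (simp flip: distrib_left distrib_right)
  qed
qed

text \<open>In the explicit polynomial, the \<open>i\<close>-th partial derivative replaces the
  \<open>i\<close>-th factor by its slope, which is 1 or -1. The terms of each sign form one of the
  two pinned expectations.\<close>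

lemma gradient_multilinear_relaxation:
  fixes f :: "real ^ 'n::finite \<Rightarrow> real"
  assumes y: "y \<in> unit_cube"
  shows "gradient_within (multilinear_relaxation f) y unit_cube =
    (\<chi> i. measure_pmf.expectation (bernoulli_vec y) (\<lambda>x. f (set_one i x))
       - measure_pmf.expectation (bernoulli_vec y) (\<lambda>x. f (set_zero i x)))"
    (is "_ = ?D")
proof (rule gradient_within_unit_cube[OF _ y])
  \<comment> \<open>\<open>\<sigma> c\<close> is the slope of \<open>bernoulli_weight c\<close>;
    \<open>Q i b\<close> is the product of the other factors that the product rule leaves.\<close>
  define \<sigma> :: "bool \<Rightarrow> real" where "\<sigma> c = (if c then 1 else -1)" for c
  define Q where "Q i b = (\<Prod>k\<in>UNIV - {i}. bernoulli_weight (b k) (y $ k))" for i and b :: "'n \<Rightarrow> bool"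
  have D: "?D $ i = (\<Sum>b\<in>UNIV. f (vertex b) * (\<sigma> (b i) * Q i b))" for i
  proof -
    have "?D $ i = (\<Sum>b | b i = True. f (vertex b) * Q i b) - (\<Sum>b | b i = False. f (vertex b) * Q i b)"
      using sum_bernoulli_weight_pinned[of "\<lambda>b. f (vertex b)" i _ y]
      by (simp add: expectation_bernoulli_vec[OF y] set_one_vertex set_zero_vertex Q_def)
    also have "\<dots> = (\<Sum>b | b i = True. f (vertex b) * (\<sigma> (b i) * Q i b))
        + (\<Sum>b | b i = False. f (vertex b) * (\<sigma> (b i) * Q i b))"
      by (simp add: \<sigma>_def sum_negf)
    also have "\<dots> = (\<Sum>b\<in>UNIV. f (vertex b) * (\<sigma> (b i) * Q i b))"
      by (subst sum.union_disjoint[symmetric]) (auto intro!: sum.cong)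
    finally show ?thesis .
  qed
  have weight: "((\<lambda>x. bernoulli_weight c (x $ k)) has_derivative (\<lambda>v. \<sigma> c * v $ k)) (at y within unit_cube)"
    for c and k :: 'n
    by (cases c) (auto simp: bernoulli_weight_def \<sigma>_def intro!: derivative_eq_intros
        bounded_linear_imp_has_derivative bounded_linear_vec_nth)
  have "((\<lambda>x. \<Sum>b\<in>UNIV. f (vertex b) * (\<Prod>k\<in>UNIV. bernoulli_weight (b k) (x $ k)))
      has_derivative (\<lambda>v. \<Sum>b\<in>UNIV. f (vertex b) * (\<Sum>i\<in>UNIV. (\<sigma> (b i) * v $ i) * Q i b)))
      (at y within unit_cube)"
    unfolding Q_def by (intro has_derivative_sum has_derivative_mult_right has_derivative_prod weight)
  moreover have "(\<Sum>b\<in>UNIV. f (vertex b) * (\<Sum>i\<in>UNIV. (\<sigma> (b i) * v $ i) * Q i b)) = ?D \<bullet> v" for v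
  proof -
    have "?D \<bullet> v = (\<Sum>i\<in>UNIV. \<Sum>b\<in>UNIV. f (vertex b) * (\<sigma> (b i) * v $ i * Q i b))"
      unfolding inner_vec_def D inner_real_def sum_distrib_right by (simp add: mult_ac)
    also have "\<dots> = (\<Sum>b\<in>UNIV. f (vertex b) * (\<Sum>i\<in>UNIV. (\<sigma> (b i) * v $ i) * Q i b))"
      unfolding sum_distrib_left by (rule sum.swap)
    finally show ?thesis by simp
  qed
  ultimately have "((\<lambda>x. \<Sum>b\<in>UNIV. f (vertex b) * (\<Prod>k\<in>UNIV. bernoulli_weight (b k) (x $ k)))
      has_derivative (\<lambda>v. ?D \<bullet> v)) (at y within unit_cube)"
    by simp
  \<comment> \<open>The polynomial formula is available only on the cube, because
    \<open>bernoulli_pmf\<close> truncates its parameter. For a derivative within the cube,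
    agreement there suffices.\<close>
  then show "(multilinear_relaxation f has_derivative (\<lambda>v. ?D \<bullet> v)) (at y within unit_cube)"
    by (rule has_derivative_transform[OF y, rotated])
      (simp add: multilinear_relaxation_def expectation_bernoulli_vec)
qed

text \<open>Triangle inequality with nonnegative weights. A bound at the vertices is enough because
  they carry the whole distribution.\<close>

lemma abs_expectation_bernoulli_vec_diff_le:
  fixes y :: "real ^ 'n::finite" and \<phi> \<psi> \<rho> :: "real ^ 'n \<Rightarrow> real"
  assumes y: "y \<in> unit_cube"
    and le: "\<And>b. \<bar>\<phi> (vertex b) - \<psi> (vertex b)\<bar> \<le> \<rho> (vertex b)"
  shows "\<bar>measure_pmf.expectation (bernoulli_vec y) \<phi> - measure_pmf.expectation (bernoulli_vec y) \<psi>\<bar>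
    \<le> measure_pmf.expectation (bernoulli_vec y) \<rho>"
proof -
  have nonneg: "0 \<le> (\<Prod>k\<in>UNIV. bernoulli_weight (b k) (y $ k))" for b
    by (intro prod_nonneg) (simp add: bernoulli_weight_nonneg[OF y])
  show ?thesis
    unfolding expectation_bernoulli_vec[OF y] sum_subtractf[symmetric] left_diff_distrib[symmetric]
    by (rule sum_abs[THEN order_trans], rule sum_mono) (simp add: abs_mult nonneg le mult_right_mono)
qed

text \<open>Each weight is at most 1, so the upper bound does not involve \<open>y\<close>. This is
  the source of the uniformity.\<close>

lemma expectation_bernoulli_vec_nonneg_le_sum:
  fixes y :: "real ^ 'n::finite" and \<rho> :: "real ^ 'n \<Rightarrow> real"
  assumes y: "y \<in> unit_cube" and \<rho>: "\<And>b. 0 \<le> \<rho> (vertex b)"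
  shows "0 \<le> measure_pmf.expectation (bernoulli_vec y) \<rho>"
    and "measure_pmf.expectation (bernoulli_vec y) \<rho> \<le> (\<Sum>b\<in>UNIV. \<rho> (vertex b))"
proof -
  have nonneg: "0 \<le> (\<Prod>k\<in>UNIV. bernoulli_weight (b k) (y $ k))" for b
    by (intro prod_nonneg) (simp add: bernoulli_weight_nonneg[OF y])
  have le_1: "(\<Prod>k\<in>UNIV. bernoulli_weight (b k) (y $ k)) \<le> 1" for b
    by (intro prod_le_1) (simp add: bernoulli_weight_nonneg[OF y] bernoulli_weight_le_1[OF y])
  show "0 \<le> measure_pmf.expectation (bernoulli_vec y) \<rho>"
    unfolding expectation_bernoulli_vec[OF y] by (intro sum_nonneg mult_nonneg_nonneg \<rho> nonneg)
  show "measure_pmf.expectation (bernoulli_vec y) \<rho> \<le> (\<Sum>b\<in>UNIV. \<rho> (vertex b))"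
    unfolding expectation_bernoulli_vec[OF y] by (intro sum_mono mult_left_le \<rho> le_1)
qed

lemma residual_nonneg: "0 \<le> residual M w R g L x"
  by (simp add: residual_def sum_nonneg)

text \<open>Triangle inequality over \<open>j\<close>, followed by
  \<open>R j L (g j x) \<le> \<bar>R j L (g j x)\<bar>\<close> in each term.\<close>

lemma residual_bound:
  assumes "\<And>j. j \<in> {1..M} \<Longrightarrow> \<bar>h j (g j x) - poly (hhat j L) (g j x)\<bar> \<le> R j L (g j x)"
  shows "\<bar>(\<Sum>j=1..M. w j * h j (g j x)) - polynomial_estimator M w hhat g L x\<bar> \<le> residual M w R g L x"
  unfolding polynomial_estimator_def residual_def sum_subtractf[symmetric] right_diff_distrib[symmetric]
proof (rule sum_abs[THEN order_trans], rule sum_mono)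
  fix j assume "j \<in> {1..M}"
  from assms[OF this] show "\<bar>w j * (h j (g j x) - poly (hhat j L) (g j x))\<bar> \<le> \<bar>w j\<bar> * \<bar>R j L (g j x)\<bar>"
    by (simp add: abs_mult mult_left_mono)
qed

lemma tendsto_residual:
  assumes "\<And>j. j \<in> {1..M} \<Longrightarrow> (\<lambda>L. R j L (g j x)) \<longlonglongrightarrow> 0"
  shows "(\<lambda>L. residual M w R g L x) \<longlonglongrightarrow> 0"
  unfolding residual_def
  by (intro tendsto_null_sum tendsto_mult_right_zero tendsto_rabs_zero assms)

text \<open>The Euclidean norm is at most the sum of the absolute coordinates, and each coordinate
  is bounded by vertex sums. The resulting majorant is the same for every \<open>y\<close> in the
  cube.\<close>

lemma norm_gradient_error_le:
  fixes y :: "real ^ 'n::finite"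
  assumes y: "y \<in> unit_cube"
  shows "norm (gradient_error M w R g L y) \<le> (\<Sum>i\<in>(UNIV :: 'n set).
    (\<Sum>b\<in>UNIV. residual M w R g L (vertex (b(i := True)))) +
    (\<Sum>b\<in>UNIV. residual M w R g L (vertex (b(i := False)))))"
proof (rule norm_le_l1_cart[THEN order_trans], rule sum_mono)
  fix i :: 'n
  show "\<bar>gradient_error M w R g L y $ i\<bar> \<le>
    (\<Sum>b\<in>UNIV. residual M w R g L (vertex (b(i := True)))) +
    (\<Sum>b\<in>UNIV. residual M w R g L (vertex (b(i := False))))"
    using expectation_bernoulli_vec_nonneg_le_sum[OF y, where \<rho> = "\<lambda>x. residual M w R g L (set_one i x)"]
      expectation_bernoulli_vec_nonneg_le_sum[OF y, where \<rho> = "\<lambda>x. residual M w R g L (set_zero i x)"]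
    by (simp add: gradient_error_def residual_nonneg set_one_vertex set_zero_vertex)
qed

theorem theorem5p1:
  fixes M :: nat
    and f :: "real ^ 'n::finite \<Rightarrow> real"
    and w :: "nat \<Rightarrow> real"
    and h :: "nat \<Rightarrow> real \<Rightarrow> real"
    and g :: "nat \<Rightarrow> real ^ 'n \<Rightarrow> real"
    and hhat :: "nat \<Rightarrow> nat \<Rightarrow> real poly"
    and R :: "nat \<Rightarrow> nat \<Rightarrow> real \<Rightarrow> real"
  assumes f_nonneg: "\<And>x. x \<in> binary_cube \<Longrightarrow> f x \<ge> 0"
    and f_eq: "\<And>x. x \<in> binary_cube \<Longrightarrow> f x = (\<Sum>j=1..M. w j * h j (g j x))"
    and h_nonneg: "\<And>j s. j \<in> {1..M} \<Longrightarrow> s \<in> {0..1} \<Longrightarrow> h j s \<ge> 0"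
    and g_range: "\<And>j x. j \<in> {1..M} \<Longrightarrow> x \<in> unit_cube \<Longrightarrow> g j x \<in> {0..1}"
    and g_multilinear: "\<And>j. j \<in> {1..M} \<Longrightarrow> multilinear_on unit_cube (g j)"
    and hhat_degree: "\<And>j L. j \<in> {1..M} \<Longrightarrow> degree (hhat j L) = L"
    and hhat_approx: "\<And>j L s. j \<in> {1..M} \<Longrightarrow> s \<in> {0..1} \<Longrightarrow>
          \<bar>h j s - poly (hhat j L) s\<bar> \<le> R j L s"
    and R_tendsto: "\<And>j s. j \<in> {1..M} \<Longrightarrow> s \<in> {0..1} \<Longrightarrow> (\<lambda>L. R j L s) \<longlonglongrightarrow> 0"
  shows "(\<forall>L. \<forall>y\<in>unit_cube.
            norm (gradient_within (multilinear_relaxation f) y unit_cube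
                  - gradient_estimator M w hhat g L y)
              \<le> norm (gradient_error M w R g L y))
       \<and> uniform_limit unit_cube (\<lambda>L y. norm (gradient_error M w R g L y)) (\<lambda>y. 0) sequentially"
proof (intro conjI allI ballI)
  have g_vertex: "g j (vertex b) \<in> {0..1}" if "j \<in> {1..M}" for j b
    using g_range[OF that] vertex_in_binary_cube binary_cube_subset_unit_cube by blast
  show "norm (gradient_within (multilinear_relaxation f) y unit_cube - gradient_estimator M w hhat g L y)
      \<le> norm (gradient_error M w R g L y)" if y: "y \<in> unit_cube" for L y
  proof (rule norm_le_componentwise_cart)
    fix i :: 'n
    let ?E = "measure_pmf.expectation (bernoulli_vec y)"
    let ?p = "polynomial_estimator M w hhat g L" and ?r = "residual M w R g L"
    have bound: "\<bar>f (vertex b) - ?p (vertex b)\<bar> \<le> ?r (vertex b)" for b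
      unfolding f_eq[OF vertex_in_binary_cube] by (intro residual_bound hhat_approx g_vertex)
    \<comment> \<open>The error is estimated separately for the two pinned values; the triangle
      inequality then adds the two bounds, which gives coordinate \<open>i\<close> of
      \<open>gradient_error\<close>.\<close>
    have "\<bar>?E (\<lambda>x. f (set_one i x)) - ?E (\<lambda>x. ?p (set_one i x))\<bar> \<le> ?E (\<lambda>x. ?r (set_one i x))"
      by (rule abs_expectation_bernoulli_vec_diff_le[OF y]) (simp add: set_one_vertex bound)
    moreover have "\<bar>?E (\<lambda>x. f (set_zero i x)) - ?E (\<lambda>x. ?p (set_zero i x))\<bar> \<le> ?E (\<lambda>x. ?r (set_zero i x))"
      by (rule abs_expectation_bernoulli_vec_diff_le[OF y]) (simp add: set_zero_vertex bound)
    ultimately show "norm ((gradient_within (multilinear_relaxation f) y unit_cube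
        - gradient_estimator M w hhat g L y) $ i) \<le> norm (gradient_error M w R g L y $ i)"
      unfolding gradient_multilinear_relaxation[OF y]
      by (simp add: gradient_estimator_def gradient_error_def)
  qed
  show "uniform_limit unit_cube (\<lambda>L y. norm (gradient_error M w R g L y)) (\<lambda>y. 0) sequentially"
  proof (rule uniform_limitI)
    fix e :: real assume "0 < e"
    \<comment> \<open>The majorant is a finite sum of residuals at vertices, so pointwise
      convergence of \<open>R\<close> makes it vanish in the limit. One threshold for
      \<open>L\<close> then serves all \<open>y\<close> at once.\<close>
    have "(\<lambda>L. \<Sum>i\<in>(UNIV :: 'n set).
        (\<Sum>b\<in>UNIV. residual M w R g L (vertex (b(i := True)))) +
        (\<Sum>b\<in>UNIV. residual M w R g L (vertex (b(i := False))))) \<longlonglongrightarrow> 0"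
      by (intro tendsto_null_sum tendsto_add_zero tendsto_residual R_tendsto g_vertex)
    from order_tendstoD(2)[OF this \<open>0 < e\<close>]
    show "\<forall>\<^sub>F L in sequentially. \<forall>y\<in>unit_cube. dist (norm (gradient_error M w R g L y)) 0 < e"
      by eventually_elim (auto intro: norm_gradient_error_le[THEN order.strict_trans1])
  qed
qed

end
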